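(* Let $B>3$ be an odd integer, and let $c_{\max}(B)$ be the largest length of a terminal cycle of the four-digit Kaprekar map in base $B$. Then $$c_{\max}(B)\le\frac{B-1}{2}.$$ Moreover, equality holds if and only if $B\ge 7$, $B$ is prime, and the least positive integer $m$ with $2^m\equiv\pm1\pmod B$ is $m=\frac{B-1}{2}$.
   Context: A four-digit string in base $B$ is a sequence of four digits in $\{0,\dots,B-1\}$ (leading zeros allowed). The four-digit Kaprekar map in base $B$ sends a string whose digits sorted in non-increasing order are $a_1\ge a_2\ge a_3\ge a_4$ to the four-digit base-$B$ string (with leading zeros if needed) of the number $$(a_1B^3+a_2B^2+a_3B+a_4)-(a_4B^3+a_3B^2+a_2B+a_1).$$ Constant strings (all four digits equal) are excluded throughout. A terminal cycle is a periodic orbit of this map consisting of nonconstant strings, and its length is the number of distinct strings in it (the minimal period). *)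

theory Defs
  imports
    "HOL-Number_Theory.Number_Theory"
    "HOL-Combinatorics.Orbits"
begin

text \<open>Digit strings are lists of naturals, most significant digit first.\<close>

definition nonconst_strings :: "nat \<Rightarrow> nat list set" where
  "nonconst_strings B =
     {s. length s = 4 \<and> set s \<subseteq> {..<B} \<and> \<not> (\<exists>d. s = replicate 4 d)}"

text \<open>The library's \<open>horner_sum\<close> is little-endian, hence the \<open>rev\<close>.\<close>

definition string_value :: "nat \<Rightarrow> nat list \<Rightarrow> nat" where
  "string_value B s = horner_sum id B (rev s)"

definition four_digits :: "nat \<Rightarrow> nat \<Rightarrow> nat list" where
  "four_digits B n = map (\<lambda>i. n div B ^ i mod B) [3, 2, 1, 0]"

text \<open>The subtraction on naturals never truncates, since the digits of the minuend are
  in non-increasing order and those of the subtrahend in non-decreasing order.\<close>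

definition kaprekar :: "nat \<Rightarrow> nat list \<Rightarrow> nat list" where
  "kaprekar B s =
     four_digits B (string_value B (rev (sort s)) - string_value B (sort s))"

text \<open>The library's \<open>orbit f s\<close> is the set of all \<open>(f ^^ n) s\<close> with \<open>n > 0\<close>, so
  \<open>s \<in> orbit f s\<close> says that \<open>s\<close> is periodic, and the cardinality of the orbit is then
  its minimal period.\<close>

definition terminal_cycle :: "nat \<Rightarrow> nat list set \<Rightarrow> bool" where
  "terminal_cycle B C \<longleftrightarrow>
     C \<subseteq> nonconst_strings B \<and>
     (\<exists>s. s \<in> orbit (kaprekar B) s \<and> C = orbit (kaprekar B) s)"

definition c_max :: "nat \<Rightarrow> nat" where
  "c_max B = Max {card C | C. terminal_cycle B C}"

end

theory Submission
  imports Defs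
begin

text \<open>
  If the sorted digits of a string are \<open>a\<^sub>1 \<ge> a\<^sub>2 \<ge> a\<^sub>3 \<ge> a\<^sub>4\<close>, its image depends only on the two gaps
  \<open>a\<^sub>1 - a\<^sub>4\<close> and \<open>a\<^sub>2 - a\<^sub>3\<close>. For odd \<open>B\<close> the map acts on the unordered pair of gaps by applying
  \<open>T x = \<bar>B - 2 x\<bar>\<close> to both, apart from degenerate pairs (a gap 0, or two gaps with the same
  image under \<open>T\<close>), which lead after a few steps to a pair of distinct odd numbers below \<open>B\<close>.
  Since \<open>T\<close> is injective on these odd numbers, a cycle never sees a degenerate pair.
  Each residue class modulo \<open>B\<close> other than 0 is, up to sign, represented by exactly one odd number
  below \<open>B\<close>, and on these classes \<open>T\<close> is multiplication by 2. Hence, with \<open>m\<close> minimal such that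
  \<open>2 ^ m \<equiv> \<plusminus>1\<close>, every cycle length is at most \<open>m\<close>, and the pair \<open>{1, B - 2} = {1, T 1}\<close> attains
  \<open>m\<close> if \<open>B \<ge> 7\<close>. The \<open>T\<close>-orbit of 1 has \<open>m\<close> elements among the \<open>(B - 1) / 2\<close> odd numbers; if it
  exhausts them, all of them are coprime to \<open>B\<close>, so \<open>B\<close> is prime.
\<close>

text \<open>The image of a string whose gaps are \<open>x\<close> and \<open>y\<close> in either order; if the smaller gap is 0,
  a borrow changes the leading digit.\<close>

definition gap_string :: "nat \<Rightarrow> nat \<Rightarrow> nat \<Rightarrow> nat list" where
  "gap_string B x y =
     (if min x y = 0 then [max x y - 1, B - 1, B - 1, B - max x y]
      else [max x y, min x y - 1, B - 1 - min x y, B - max x y])"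

definition tent :: "nat \<Rightarrow> nat \<Rightarrow> nat" where
  "tent B x = (if 2 * x < B then B - 2 * x else 2 * x - B)"

definition odds :: "nat \<Rightarrow> nat set" where
  "odds B = {x. odd x \<and> x < B}"

section \<open>The Kaprekar map in terms of gaps\<close>

lemma gap_string_commute: "gap_string B x y = gap_string B y x"
  unfolding gap_string_def by (simp only: max.commute[of x y] min.commute[of x y])

lemma four_digits_string_value:
  assumes "p < B" "q < B" "r < B" "s < B"
  shows "four_digits B (string_value B [p, q, r, s]) = [p, q, r, s]"
proof -
  have 0: "0 < B" using assms by simp
  have v: "string_value B [p, q, r, s] = s + B * (r + B * (q + B * p))"
    by (simp add: string_value_def)
  have 1: "(s + B * t) div B = t" "(s + B * t) mod B = s" for t
    using assms 0 by simp_all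
  have 2: "(r + B * t) div B = t" "(r + B * t) mod B = r" for t
    using assms 0 by simp_all
  have 3: "(q + B * t) div B = t" "(q + B * t) mod B = q" for t
    using assms 0 by simp_all
  have "B ^ 2 = B * B" "B ^ 3 = B * (B * B)" by (simp_all add: power2_eq_square power3_eq_cube)
  then show ?thesis
    unfolding v four_digits_def using assms by (simp add: div_mult2_eq 1 2 3)
qed

text \<open>With \<open>u = a - d\<close> and \<open>v = b - c\<close> the difference is
  \<open>u (B^3 - 1) + v (B^2 - B)\<close>. Borrowing turns this into the digits
  \<open>u, v - 1, B - 1 - v, B - u\<close>, and for \<open>v = 0\<close> the borrow runs on into
  the leading digit.\<close>

lemma kaprekar_sorted:
  assumes "sort s = [d, c, b, a]" "d \<le> c" "c \<le> b" "b \<le> a" "d < a" "a < B"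
  shows "kaprekar B s = gap_string B (a - d) (b - c)"
proof -
  obtain u where u: "a = d + u" using assms by (metis le_Suc_ex le_less)
  obtain v where v: "b = c + v" using assms by (metis le_Suc_ex)
  have uv: "v \<le> u" "u < B" "0 < u" using assms u v by linarith+
  obtain z where z: "B = u + z" "0 < z" using uv by (metis less_imp_add_positive)
  have main: "string_value B [a, b, c, d] = string_value B [d, c, b, a] + string_value B (gap_string B u v)"
  proof (cases v)
    case 0
    obtain u' where "u = Suc u'" using uv by (cases u) auto
    with 0 uv z show ?thesis unfolding u v
      by (simp add: gap_string_def string_value_def algebra_simps)
  next
    case (Suc v')
    obtain w where w: "B = v + 1 + w" using uv
      by (metis Suc_eq_plus1 Suc_leI le_Suc_ex le_less_trans)
    \<comment> \<open>Over the integers the complementary digits \<open>w\<close> and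
      \<open>z\<close> can be eliminated in favour of \<open>B\<close>, which leaves a polynomial
      identity.\<close>
    have "int (string_value B [a, b, c, d]) = int (string_value B [d, c, b, a] + string_value B [u, v', w, z])"
    proof -
      have i: "int w = int B - int v' - 2" "int z = int B - int u" using w z Suc by simp_all
      show ?thesis unfolding u v Suc by (simp add: string_value_def i algebra_simps)
    qed
    moreover have "gap_string B u v = [u, v', w, z]"
      using uv w z Suc by (auto simp: gap_string_def min_def max_def)
    ultimately show ?thesis by simp
  qed
  have "four_digits B (string_value B (gap_string B u v)) = gap_string B u v"
    using uv unfolding gap_string_def by (auto intro!: four_digits_string_value)
  then show ?thesis using main assms(1) by (simp add: kaprekar_def u v)
qed

lemma kaprekar_mset:
  assumes "mset s = {#d, c, b, a#}" "d \<le> c" "c \<le> b" "b \<le> a" "d < a" "a < B"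
  shows "kaprekar B s = gap_string B (a - d) (b - c)"
  by (rule kaprekar_sorted) (use assms in \<open>auto intro!: properties_for_sort\<close>)

text \<open>The digits form two pairs, \<open>{x, B - x}\<close> with sum \<open>B\<close> and
  \<open>{y - 1, B - 1 - y}\<close> with sum \<open>B - 2\<close>. Let \<open>p\<close> and
  \<open>q\<close> be their larger members. Unless \<open>p = q + 1\<close>, one pair is nested
  inside the other, so the new gaps are the differences within the pairs, namely
  \<open>tent B x\<close> and \<open>tent B y\<close>. The case \<open>p = q + 1\<close> is exactly
  that of equal images.\<close>

lemma kaprekar_gap_string_neq_aux:
  assumes "odd B" "0 < y" "y \<le> x" "x < B" "tent B x \<noteq> tent B y"
  shows "kaprekar B (gap_string B x y) = gap_string B (tent B x) (tent B y)"
proof -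
  define p where "p = max x (B - x)"
  define q where "q = max (y - 1) (B - 1 - y)"
  have 1: "{#x, B - x#} = {#B - p, p#}"
    using assms(4) by (cases "x \<le> B - x") (simp_all add: p_def add_mset_commute)
  have "y < B" using assms(3,4) by simp
  then have 2: "{#y - 1, B - 1 - y#} = {#B - 2 - q, q#}"
    using assms(2) by (cases "y - 1 \<le> B - 1 - y") (simp_all add: q_def add_mset_commute)
  have "gap_string B x y = [x, y - 1, B - 1 - y, B - x]"
    using assms(2,3) by (simp add: gap_string_def max_absorb1 min_absorb2)
  then have "mset (gap_string B x y) = {#x, B - x#} + {#y - 1, B - 1 - y#}"
    by (simp add: add_mset_commute)
  then have s: "mset (gap_string B x y) = {#B - p, p#} + {#B - 2 - q, q#}"
    unfolding 1 2 .
  have t: "tent B x = 2 * p - B" "tent B y = 2 * q + 2 - B"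
    using assms(2-4) by (auto simp: tent_def p_def q_def max_def)
  obtain h where h: "B = 2 * h + 1" using assms(1) by (rule oddE)
  have "B < 2 * p" "p < B"
    using h assms(2-4) by (cases "x \<le> h"; auto simp: p_def max_def)+
  moreover have "B \<le> 2 * q + 1" "q + 2 \<le> B"
    using h assms(2-4) by (cases "y \<le> h"; auto simp: q_def max_def)+
  ultimately have b: "B < 2 * p" "p < B" "B \<le> 2 * q + 1" "q + 2 \<le> B" .
  have ne: "p \<noteq> q + 1" using assms(5) t by auto
  show ?thesis
  proof (cases "q + 2 \<le> p")
    case True
    have "kaprekar B (gap_string B x y) = gap_string B (p - (B - p)) (q - (B - 2 - q))"
    proof (rule kaprekar_mset)
      show "mset (gap_string B x y) = {#B - p, B - 2 - q, q, p#}"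
        unfolding s by (simp add: add_mset_commute)
    qed (use b True in linarith)+
    moreover have "p - (B - p) = tent B x" "q - (B - 2 - q) = tent B y"
      using b t by linarith+
    ultimately show ?thesis by simp
  next
    case False
    have "kaprekar B (gap_string B x y) = gap_string B (q - (B - 2 - q)) (p - (B - p))"
    proof (rule kaprekar_mset)
      show "mset (gap_string B x y) = {#B - 2 - q, B - p, p, q#}"
        unfolding s by (simp add: add_mset_commute)
    qed (use b False ne in linarith)+
    moreover have "p - (B - p) = tent B x" "q - (B - 2 - q) = tent B y"
      using b t by linarith+
    ultimately show ?thesis by (simp add: gap_string_commute)
  qed
qed

lemma kaprekar_gap_string_neq:
  assumes "odd B" "0 < x" "x < B" "0 < y" "y < B" "tent B x \<noteq> tent B y"
  shows "kaprekar B (gap_string B x y) = gap_string B (tent B x) (tent B y)"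
  using kaprekar_gap_string_neq_aux[of B x y] kaprekar_gap_string_neq_aux[of B y x] assms
  by (metis gap_string_commute nle_le)

text \<open>Here the larger digits are \<open>p\<close> and \<open>p - 1\<close>, so the two pairs
  interleave: the outer gap grows by 1 and the inner one shrinks by 1.\<close>

lemma kaprekar_gap_string_eq:
  assumes "odd B" "0 < y" "y \<le> x" "x < B" "tent B x = tent B y"
  shows "kaprekar B (gap_string B x y) = gap_string B (tent B x + 1) (tent B x - 1)"
proof -
  define p where "p = max x (B - x)"
  have y: "y = x \<or> y = B - x"
    using assms by (auto simp: tent_def split: if_splits)
  have 1: "{#x, B - x#} = {#B - p, p#}"
    using assms(4) by (cases "x \<le> B - x") (simp_all add: p_def add_mset_commute)
  have "{#y - 1, B - 1 - y#} = {#x - 1, B - x - 1#}"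
    using y assms(2-4) by (auto simp: add_mset_commute)
  also have "\<dots> = {#B - p - 1, p - 1#}"
    using assms(4) by (cases "x \<le> B - x") (simp_all add: p_def add_mset_commute)
  finally have 2: "{#y - 1, B - 1 - y#} = {#B - p - 1, p - 1#}" .
  have "gap_string B x y = [x, y - 1, B - 1 - y, B - x]"
    using assms(2,3) by (simp add: gap_string_def max_absorb1 min_absorb2)
  then have "mset (gap_string B x y) = {#x, B - x#} + {#y - 1, B - 1 - y#}"
    by (simp add: add_mset_commute)
  then have s: "mset (gap_string B x y) = {#B - p - 1, B - p, p - 1, p#}"
    unfolding 1 2 by (simp add: add_mset_commute)
  have t: "tent B x = 2 * p - B"
    using assms(1-4) by (auto simp: tent_def p_def max_def)
  obtain h where h: "B = 2 * h + 1" using assms(1) by (rule oddE)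
  have b: "B < 2 * p" "p < B"
    using h assms(2-4) by (cases "x \<le> h"; auto simp: p_def max_def)+
  have "kaprekar B (gap_string B x y) = gap_string B (p - (B - p - 1)) (p - 1 - (B - p))"
    by (rule kaprekar_mset[OF s]) (use b in linarith)+
  moreover have "p - (B - p - 1) = tent B x + 1" "p - 1 - (B - p) = tent B x - 1"
    using b t by linarith+
  ultimately show ?thesis by simp
qed

text \<open>The two largest digits are both \<open>B - 1\<close>, so each new gap is the distance
  from \<open>B - 1\<close> to one of the digits \<open>x - 1\<close> and
  \<open>B - x\<close>.\<close>

lemma kaprekar_gap_string_0:
  assumes "odd B" "0 < x" "x < B"
  shows "kaprekar B (gap_string B x 0) = gap_string B (B - x) (x - 1)"
proof -
  define p where "p = max (x - 1) (B - x)"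
  define q where "q = min (x - 1) (B - x)"
  have "{#x - 1, B - x#} = {#q, p#}"
    by (cases "x - 1 \<le> B - x") (simp_all add: p_def q_def add_mset_commute)
  moreover have "mset (gap_string B x 0) = {#x - 1, B - x#} + {#B - 1, B - 1#}"
    by (simp add: gap_string_def add_mset_commute)
  ultimately have s: "mset (gap_string B x 0) = {#q, p, B - 1, B - 1#}" by simp
  have "2 < B" using assms by (cases "B = 2") auto
  then have b: "q \<le> p" "q < B - 1" "p \<le> B - 1"
    using assms(2,3) unfolding p_def q_def by linarith+
  have k: "kaprekar B (gap_string B x 0) = gap_string B (B - 1 - q) (B - 1 - p)"
    by (rule kaprekar_mset[OF s]) (use b assms in linarith)+
  consider "p = x - 1" "q = B - x" | "p = B - x" "q = x - 1"
    unfolding p_def q_def by linarith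
  then show ?thesis
  proof cases
    case 1
    then have "B - 1 - q = x - 1" "B - 1 - p = B - x" using assms by auto
    then show ?thesis using k by (simp add: gap_string_commute)
  next
    case 2
    then have "B - 1 - q = B - x" "B - 1 - p = x - 1" using assms by auto
    then show ?thesis using k by simp
  qed
qed

lemma kaprekar_nonconst:
  assumes "s \<in> nonconst_strings B"
  obtains x y where "kaprekar B s = gap_string B x y" "y \<le> x" "0 < x" "x < B"
proof -
  have l: "length (sort s) = 4" and S: "set (sort s) \<subseteq> {..<B}"
    using assms by (auto simp: nonconst_strings_def)
  then obtain d c b a where s: "sort s = [d, c, b, a]"
    by (auto simp: length_Suc_conv numeral_eq_Suc simp del: length_sort)
  have o: "d \<le> c" "c \<le> b" "b \<le> a" using sorted_sort[of s] unfolding s by auto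
  have "a < B" using S unfolding s by simp
  have "d \<noteq> a"
  proof
    assume "d = a"
    then have "set (sort s) = {a}" using o unfolding s by auto
    then have "set s = {a}" by simp
    then have "s = replicate (length s) a" by (intro replicate_eqI) auto
    then show False using assms by (auto simp: nonconst_strings_def)
  qed
  then have "kaprekar B s = gap_string B (a - d) (b - c)"
    using o \<open>a < B\<close> by (intro kaprekar_sorted[OF s]) auto
  moreover have "b - c \<le> a - d" "0 < a - d" "a - d < B"
    using o \<open>d \<noteq> a\<close> \<open>a < B\<close> by linarith+
  ultimately show ?thesis by (rule that)
qed

section \<open>The tent map on odd numbers\<close>

lemma tent_odds: "odd B \<Longrightarrow> 0 < x \<Longrightarrow> x < B \<Longrightarrow> tent B x \<in> odds B"
  by (auto simp: tent_def odds_def)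

lemma odds_pos: "x \<in> odds B \<Longrightarrow> 0 < x"
  by (auto simp: odds_def intro: odd_pos)

lemma tent_mem_odds: "odd B \<Longrightarrow> x \<in> odds B \<Longrightarrow> tent B x \<in> odds B"
  using odds_pos tent_odds by (auto simp: odds_def)

lemma funpow_tent_mem_odds: "odd B \<Longrightarrow> x \<in> odds B \<Longrightarrow> (tent B ^^ n) x \<in> odds B"
  by (induction n) (auto intro: tent_mem_odds)

lemma tent_eq_cases:
  assumes "tent B x = tent B y"
  shows "x = y \<or> x + y = B"
  using assms by (auto simp: tent_def split: if_splits)

text \<open>The only other point with the same image as \<open>x\<close> is \<open>B - x\<close>,
  which is even for odd \<open>x\<close>.\<close>

lemma tent_inj_on:
  assumes "odd B"
  shows "inj_on (tent B) (odds B)"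
proof (rule inj_onI)
  fix x y assume xy: "x \<in> odds B" "y \<in> odds B" "tent B x = tent B y"
  then have "even (x + y)" by (simp add: odds_def)
  then have "x + y \<noteq> B" using assms by auto
  then show "x = y" using tent_eq_cases[OF xy(3)] by simp
qed

section \<open>Strings with distinct odd gaps\<close>

text \<open>On these strings the degenerate cases never arise: by injectivity of
  \<open>tent B\<close> the gaps stay odd and distinct forever.\<close>

definition regular :: "nat \<Rightarrow> nat list set" where
  "regular B = {gap_string B x y | x y. x \<in> odds B \<and> y \<in> odds B \<and> x \<noteq> y}"

lemma regularI: "x \<in> odds B \<Longrightarrow> y \<in> odds B \<Longrightarrow> x \<noteq> y \<Longrightarrow> gap_string B x y \<in> regular B"
  by (auto simp: regular_def)

lemma kaprekar_regular:
  assumes "odd B" "x \<in> odds B" "y \<in> odds B" "x \<noteq> y"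
  shows "kaprekar B (gap_string B x y) = gap_string B (tent B x) (tent B y)"
  using assms odds_pos[OF assms(2)] odds_pos[OF assms(3)] inj_onD[OF tent_inj_on[OF assms(1)]]
  by (intro kaprekar_gap_string_neq) (auto simp: odds_def)

lemma funpow_tent_neq:
  assumes "odd B" "x \<in> odds B" "y \<in> odds B" "x \<noteq> y"
  shows "(tent B ^^ n) x \<noteq> (tent B ^^ n) y"
proof (induction n)
  case (Suc n)
  then show ?case
    using inj_onD[OF tent_inj_on[OF assms(1)]] funpow_tent_mem_odds[OF assms(1)] assms by auto
qed (use assms in simp)

lemma funpow_kaprekar_regular:
  assumes "odd B" "x \<in> odds B" "y \<in> odds B" "x \<noteq> y"
  shows "(kaprekar B ^^ n) (gap_string B x y) = gap_string B ((tent B ^^ n) x) ((tent B ^^ n) y)"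
proof (induction n)
  case (Suc n)
  then show ?case
    using kaprekar_regular[OF assms(1)] funpow_tent_mem_odds[OF assms(1)] funpow_tent_neq[OF assms] assms
    by simp
qed simp

lemma gap_string_eq_iff:
  assumes "0 < x" "0 < y" "0 < x'" "0 < y'"
  shows "gap_string B x y = gap_string B x' y' \<longleftrightarrow> x = x' \<and> y = y' \<or> x = y' \<and> y = x'"
proof
  assume "gap_string B x y = gap_string B x' y'"
  moreover have "0 < min x y" "0 < min x' y'" using assms by simp_all
  ultimately have "max x y = max x' y'" "min x y - 1 = min x' y' - 1"
    by (simp_all add: gap_string_def)
  then have "max x y = max x' y'" "min x y = min x' y'"
    using \<open>0 < min x y\<close> \<open>0 < min x' y'\<close> by linarith+
  then show "x = x' \<and> y = y' \<or> x = y' \<and> y = x'" by linarith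
qed (auto simp: gap_string_commute)

lemma regular_subset_nonconst:
  assumes "odd B"
  shows "regular B \<subseteq> nonconst_strings B"
proof
  fix s assume "s \<in> regular B"
  then obtain x y where xy: "x \<in> odds B" "y \<in> odds B" "s = gap_string B x y"
    by (auto simp: regular_def)
  then have p: "0 < x" "0 < y" "x < B" "y < B" using odds_pos by (auto simp: odds_def)
  \<comment> \<open>By parity the first digit and the last digit, which add up to \<open>B\<close>,
    differ.\<close>
  have "max x y + max x y \<noteq> B" using assms by (metis even_add)
  then have "max x y \<noteq> B - max x y" using p by auto
  then have "\<not> (\<exists>d. s = replicate 4 d)"
    using p xy by (auto simp: gap_string_def numeral_eq_Suc)
  then show "s \<in> nonconst_strings B"
    using p xy by (auto simp: nonconst_strings_def gap_string_def)
qed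

section \<open>Every nonconstant string reaches a regular one\<close>

definition reaches_regular :: "nat \<Rightarrow> nat list \<Rightarrow> bool" where
  "reaches_regular B s \<longleftrightarrow> (\<exists>k. (kaprekar B ^^ k) s \<in> regular B)"

lemma reaches_regular_base: "s \<in> regular B \<Longrightarrow> reaches_regular B s"
  by (auto simp: reaches_regular_def intro: exI[of _ 0])

lemma reaches_regular_step: "reaches_regular B (kaprekar B s) \<Longrightarrow> reaches_regular B s"
  unfolding reaches_regular_def by (metis funpow_swap1 funpow.simps(2) o_apply)

lemma reaches_regular_neq:
  assumes "odd B" "0 < x" "x < B" "0 < y" "y < B" "tent B x \<noteq> tent B y"
  shows "reaches_regular B (gap_string B x y)"
  by (rule reaches_regular_step, rule reaches_regular_base)
    (use assms in \<open>simp add: kaprekar_gap_string_neq regularI tent_odds\<close>)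

text \<open>If both gaps have the same image \<open>t\<close>, the next gaps are
  \<open>t + 1\<close> and \<open>t - 1\<close>. Their sum is even, hence not \<open>B\<close>, so
  if both are positive their images differ. The exception \<open>t = 1\<close> gives the gaps 2 and
  0, followed by the odd gaps \<open>B - 2\<close> and 1, distinct because
  \<open>B > 3\<close>.\<close>

lemma reaches_regular_pos_aux:
  assumes "odd B" "3 < B" "0 < y" "y \<le> x" "x < B"
  shows "reaches_regular B (gap_string B x y)"
proof (cases "tent B x = tent B y")
  case True
  define t where "t = tent B x"
  have t: "odd t" "t < B" using tent_odds[of B x] assms by (auto simp: t_def odds_def)
  have "reaches_regular B (gap_string B (t + 1) (t - 1))"
  proof (cases "t = 1")
    case True
    have "B - 2 \<in> odds B" "1 \<in> odds B" "B - 2 \<noteq> 1" using assms by (auto simp: odds_def)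
    then have "gap_string B (B - 2) (2 - 1) \<in> regular B" by (auto intro: regularI)
    then have "kaprekar B (gap_string B 2 0) \<in> regular B"
      using assms by (subst kaprekar_gap_string_0) auto
    then show ?thesis using True
      by (auto intro: reaches_regular_step reaches_regular_base simp: numeral_2_eq_2)
  next
    case False
    then have "1 < t" using t by (cases t) auto
    moreover have "t + 1 < B" using t assms(1) by (metis Suc_eq_plus1 Suc_lessI even_Suc)
    moreover have "t + 1 + (t - 1) \<noteq> B" using \<open>1 < t\<close> assms(1) by auto
    ultimately show ?thesis
      using tent_eq_cases[of B "t + 1" "t - 1"] assms by (intro reaches_regular_neq) auto
  qed
  then show ?thesis
    using kaprekar_gap_string_eq[of B y x] True assms t_def
    by (simp add: reaches_regular_step)
qed (use assms in \<open>auto intro: reaches_regular_neq\<close>)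

lemma reaches_regular_pos:
  assumes "odd B" "3 < B" "0 < y" "0 < x" "x < B" "y < B"
  shows "reaches_regular B (gap_string B x y)"
  using reaches_regular_pos_aux[of B x y] reaches_regular_pos_aux[of B y x] assms
  by (metis gap_string_commute nle_le)

text \<open>One step leads to the gaps \<open>B - x\<close> and \<open>x - 1\<close>, both positive
  unless \<open>x = 1\<close>. In that case the gaps run through \<open>1, 0\<close>, then
  \<open>B - 1, 0\<close>, then \<open>1, B - 2\<close>.\<close>

lemma reaches_regular_zero:
  assumes "odd B" "3 < B" "0 < x" "x < B"
  shows "reaches_regular B (gap_string B x 0)"
proof (cases "x = 1")
  case True
  have "reaches_regular B (gap_string B 1 (B - 2))"
    using assms by (intro reaches_regular_pos) auto
  moreover have "kaprekar B (gap_string B (B - 1) 0) = gap_string B 1 (B - 2)"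
    using assms by (subst kaprekar_gap_string_0) (auto simp: numeral_2_eq_2)
  moreover have "kaprekar B (gap_string B 1 0) = gap_string B (B - 1) 0"
    using assms by (subst kaprekar_gap_string_0) auto
  ultimately show ?thesis using True by (metis reaches_regular_step)
next
  case False
  then have "reaches_regular B (gap_string B (B - x) (x - 1))"
    using assms by (intro reaches_regular_pos) auto
  then show ?thesis
    using kaprekar_gap_string_0 assms by (simp add: reaches_regular_step)
qed

lemma reaches_regular_nonconst:
  assumes "odd B" "3 < B" "s \<in> nonconst_strings B"
  shows "reaches_regular B s"
proof -
  obtain x y where xy: "kaprekar B s = gap_string B x y" "y \<le> x" "0 < x" "x < B"
    using kaprekar_nonconst[OF assms(3)] .
  have "reaches_regular B (gap_string B x y)"
    using reaches_regular_zero[of B x] reaches_regular_pos[of B y x] assms xy by (cases "y = 0") auto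
  then show ?thesis using xy by (metis reaches_regular_step)
qed

section \<open>Terminal cycles as orbits of regular strings\<close>

text \<open>A cycle is the orbit of each of its elements, so its starting point can be moved to the
  regular string that it reaches.\<close>

lemma terminal_cycle_regular:
  assumes "odd B" "3 < B" "terminal_cycle B C"
  obtains x y where "x \<in> odds B" "y \<in> odds B" "x \<noteq> y" "C = orbit (kaprekar B) (gap_string B x y)"
proof -
  obtain s where s: "s \<in> C" "C = orbit (kaprekar B) s" "C \<subseteq> nonconst_strings B"
    using assms(3) by (auto simp: terminal_cycle_def)
  then have cyc: "cyclic_on (kaprekar B) C" by (auto simp: cyclic_on_def)
  obtain k where k: "(kaprekar B ^^ k) s \<in> regular B"
    using reaches_regular_nonconst[OF assms(1,2)] s by (auto simp: reaches_regular_def)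
  have "(kaprekar B ^^ k) s \<in> C" using cyc s(1) by (rule cyclic_on_funpow_in)
  then have "C = orbit (kaprekar B) ((kaprekar B ^^ k) s)"
    using orbit_cyclic_eq3[OF cyc] by simp
  then show ?thesis using k that by (auto simp: regular_def)
qed

lemma terminal_cycleI:
  assumes "odd B" "x \<in> odds B" "y \<in> odds B" "x \<noteq> y"
    and "0 < m" "(kaprekar B ^^ m) (gap_string B x y) = gap_string B x y"
  shows "terminal_cycle B (orbit (kaprekar B) (gap_string B x y))"
proof -
  have "gap_string B x y \<in> orbit (kaprekar B) (gap_string B x y)"
    unfolding orbit_altdef mem_Collect_eq using assms(5,6) by metis
  moreover have "orbit (kaprekar B) (gap_string B x y) \<subseteq> regular B"
    unfolding orbit_altdef funpow_kaprekar_regular[OF assms(1-4)]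
    using regularI[OF funpow_tent_mem_odds funpow_tent_mem_odds funpow_tent_neq] assms(1-4) by blast
  ultimately show ?thesis
    using regular_subset_nonconst[OF assms(1)] by (auto simp: terminal_cycle_def)
qed

lemma card_orbit_le:
  assumes "0 < m" "(f ^^ m) s = s"
  shows "card (orbit f s) \<le> m"
proof -
  have "orbit f s = (\<lambda>k. (f ^^ k) s) ` {..<m}"
    using orbit_altdef_bounded[OF assms(2,1)] by auto
  then show ?thesis using card_image_le[of "{..<m}" "\<lambda>k. (f ^^ k) s"] by simp
qed

lemma card_orbit_eq:
  assumes "0 < m" "(f ^^ m) s = s" "\<And>k. 0 < k \<Longrightarrow> k < m \<Longrightarrow> (f ^^ k) s \<noteq> s"
  shows "card (orbit f s) = m"
proof -
  have "orbit f s = (\<lambda>k. (f ^^ k) s) ` {0..<m}"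
    using orbit_altdef_bounded[OF assms(2,1)] by auto
  then show ?thesis using card_image[OF inj_on_funpow_least[OF assms(2,3)]] by simp
qed

section \<open>Congruence up to sign, and the tent map as doubling\<close>

definition pm_cong :: "int \<Rightarrow> int \<Rightarrow> int \<Rightarrow> bool" where
  "pm_cong n a b \<longleftrightarrow> [a = b] (mod n) \<or> [a = - b] (mod n)"

lemma pm_cong_iff_dvd: "pm_cong n a b \<longleftrightarrow> n dvd a - b \<or> n dvd a + b"
  by (simp add: pm_cong_def cong_iff_dvd_diff)

lemma pm_cong_trans:
  assumes "pm_cong n a b" "pm_cong n b c"
  shows "pm_cong n a c"
proof -
  \<comment> \<open>These are the four combinations of signs in the two assumptions.\<close>
  have "a - b + (b - c) = a - c" "a - b + (b + c) = a + c"
    "a + b - (b - c) = a + c" "a + b - (b + c) = a - c" by simp_all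
  then show ?thesis using assms unfolding pm_cong_iff_dvd by (metis dvd_add dvd_diff)
qed

lemma pm_cong_sym: "pm_cong n a b \<Longrightarrow> pm_cong n b a"
  unfolding pm_cong_iff_dvd by (metis add.commute dvd_diff_commute)

lemma pm_cong_mult_left: "pm_cong n a b \<Longrightarrow> pm_cong n (c * a) (c * b)"
  unfolding pm_cong_iff_dvd by (metis dvd_mult distrib_left right_diff_distrib)

lemma pm_cong_tent: "pm_cong (int B) (int (tent B x)) (2 * int x)"
proof (cases "2 * x < B")
  case True
  then have "int (tent B x) + 2 * int x = int B" by (simp add: tent_def)
  then show ?thesis unfolding pm_cong_iff_dvd by simp
next
  case False
  then have "int (tent B x) - 2 * int x = - int B" by (simp add: tent_def)
  then show ?thesis unfolding pm_cong_iff_dvd by simp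
qed

lemma pm_cong_funpow_tent: "pm_cong (int B) (int ((tent B ^^ n) x)) (2 ^ n * int x)"
proof (induction n)
  case 0
  then show ?case by (simp add: pm_cong_def)
next
  case (Suc n)
  then show ?case
    using pm_cong_trans[OF pm_cong_tent pm_cong_mult_left[of "int B" _ _ 2]]
    by (simp add: mult.assoc)
qed

text \<open>Equal residues below \<open>B\<close> coincide. Opposite ones would need
  \<open>x + y = B\<close>, as \<open>0 < x + y < 2 B\<close>, but \<open>x + y\<close> is
  even.\<close>

lemma odds_pm_cong_eq:
  assumes "odd B" "x \<in> odds B" "y \<in> odds B" "pm_cong (int B) (int x) (int y)"
  shows "x = y"
proof -
  have b: "x < B" "y < B" "even (x + y)" "0 < x" using assms odds_pos by (auto simp: odds_def)
  from assms(4) consider "[int x = int y] (mod int B)" | "int B dvd int (x + y)"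
    by (auto simp: pm_cong_def cong_iff_dvd_diff)
  then show ?thesis
  proof cases
    case 1
    then show ?thesis using b by (simp add: cong_int_iff cong_less_modulus_unique_nat)
  next
    case 2
    then have "B dvd x + y" by (simp only: int_dvd_int_iff)
    then obtain k where k: "x + y = B * k" ..
    moreover have "x + y < B * 2" "0 < x + y" using b by auto
    ultimately have "k < 2" "0 < k" by (metis mult_less_cancel1, metis gr0I mult_0_right less_irrefl)
    then have "x + y = B" using k by (simp add: less_2_cases_iff)
    then show ?thesis using b(3) assms(1) by simp
  qed
qed

text \<open>A single exponent serves every starting point, coprime to \<open>B\<close> or not; this
  gives one bound for all cycles.\<close>

lemma funpow_tent_id:
  assumes "odd B" "x \<in> odds B" "pm_cong (int B) (2 ^ m) 1"
  shows "(tent B ^^ m) x = x"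
proof -
  have "pm_cong (int B) (2 ^ m * int x) (int x)"
    using pm_cong_mult_left[OF assms(3), of "int x"] by (simp add: mult.commute)
  then show ?thesis
    using odds_pm_cong_eq pm_cong_trans[OF pm_cong_funpow_tent] funpow_tent_mem_odds assms by blast
qed

lemma funpow_tent_one_imp:
  assumes "(tent B ^^ m) 1 = 1"
  shows "pm_cong (int B) (2 ^ m) 1"
  using pm_cong_sym[OF pm_cong_funpow_tent[of B m 1]] assms by simp

section \<open>The order of 2 up to sign, and primality\<close>

text \<open>For odd \<open>B\<close> this is the order of 2 in the unit group modulo
  \<open>B\<close> divided by \<open>{1, -1}\<close>.\<close>

definition pm_order :: "nat \<Rightarrow> nat" where
  "pm_order B = (LEAST m. m > 0 \<and> pm_cong (int B) (2 ^ m) 1)"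

lemma pm_order_props:
  assumes "odd B"
  shows "0 < pm_order B" "pm_cong (int B) (2 ^ pm_order B) 1"
proof -
  \<comment> \<open>Euler's theorem provides an admissible exponent, so the minimum is
    attained.\<close>
  have "0 < totient B" using assms by (auto intro: odd_pos)
  moreover have "pm_cong (int B) (2 ^ totient B) 1"
    using euler_theorem[of 2 B] assms by (simp add: pm_cong_def flip: cong_int_iff)
  ultimately show "0 < pm_order B"
    "pm_cong (int B) (2 ^ pm_order B) 1"
    using LeastI[of "\<lambda>m. m > 0 \<and> pm_cong (int B) (2 ^ m) 1" "totient B"]
    unfolding pm_order_def by auto
qed

lemma funpow_tent_one_neq:
  assumes "0 < k" "k < pm_order B"
  shows "(tent B ^^ k) 1 \<noteq> 1"
  using funpow_tent_one_imp[of k B] not_less_Least[of k] assms unfolding pm_order_def by blast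

lemma one_mem_odds: "3 < B \<Longrightarrow> 1 \<in> odds B"
  by (simp add: odds_def)

lemma inj_on_funpow_tent_one:
  assumes "odd B" "3 < B"
  shows "inj_on (\<lambda>k. (tent B ^^ k) 1) {0..<pm_order B}"
  using funpow_tent_id pm_order_props one_mem_odds assms funpow_tent_one_neq
  by (intro inj_on_funpow_least) blast+

lemma finite_odds: "finite (odds B)"
  by (rule finite_subset[of _ "{..<B}"]) (auto simp: odds_def)

lemma card_odds:
  assumes "odd B"
  shows "card (odds B) = (B - 1) div 2"
proof -
  obtain h where h: "B = 2 * h + 1" using assms by (rule oddE)
  have "odds B = (\<lambda>i. 2 * i + 1) ` {..<h}"
    using h by (auto simp: odds_def elim!: oddE)
  then show ?thesis using h by (simp add: card_image inj_on_def)
qed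

lemma pm_order_le:
  assumes "odd B" "3 < B"
  shows "pm_order B \<le> (B - 1) div 2"
proof -
  have "(\<lambda>k. (tent B ^^ k) 1) ` {0..<pm_order B} \<subseteq> odds B"
    using funpow_tent_mem_odds one_mem_odds assms by auto
  from card_mono[OF finite_odds this] show ?thesis
    using card_image[OF inj_on_funpow_tent_one[OF assms]] card_odds[OF assms(1)] by simp
qed

text \<open>Divisibility travels backwards along the orbit: \<open>tent B z\<close> is
  \<open>2 z\<close> up to sign modulo \<open>d\<close>, and 2 can be cancelled because
  \<open>d\<close> is odd.\<close>

lemma dvd_funpow_tent:
  assumes "odd B" "d dvd B" "d dvd (tent B ^^ k) x"
  shows "d dvd x"
  using assms(3)
proof (induction k)
  case (Suc k)
  define z where "z = (tent B ^^ k) x"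
  have "d dvd tent B z" using Suc.prems by (simp add: z_def)
  then have "d dvd 2 * z"
    using assms(2) by (auto simp: tent_def dvd_diff_nat dest: dvd_diffD dvd_diffD1 split: if_splits)
  moreover have "coprime d 2" using assms by (auto dest: dvd_trans)
  ultimately have "d dvd z" by (simp add: coprime_dvd_mult_right_iff)
  then show ?case using Suc.IH z_def by simp
qed simp

lemma pm_order_eq_imp_prime:
  assumes "odd B" "3 < B" "pm_order B = (B - 1) div 2"
  shows "prime B"
proof -
  have sub: "(\<lambda>k. (tent B ^^ k) 1) ` {0..<pm_order B} \<subseteq> odds B"
    using funpow_tent_mem_odds one_mem_odds assms by auto
  have "(\<lambda>k. (tent B ^^ k) 1) ` {0..<pm_order B} = odds B"
    using card_image[OF inj_on_funpow_tent_one[OF assms(1,2)]] card_odds[OF assms(1)] assms(3)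
    by (intro card_subset_eq finite_odds sub) simp
  then have surj: "\<exists>k. x = (tent B ^^ k) 1" if "x \<in> odds B" for x
    using that by blast
  have "d = 1 \<or> d = B" if "d dvd B" for d
  proof (rule disjCI)
    assume "d \<noteq> B"
    \<comment> \<open>A proper divisor of \<open>B\<close> is itself one of the odd numbers on the
      orbit of 1, so it must divide 1.\<close>
    then have "d \<in> odds B"
      using that assms(1,2) dvd_imp_le[OF that] by (auto simp: odds_def dest: dvd_trans)
    then obtain k where "d = (tent B ^^ k) 1" using surj by blast
    then show "d = 1" using dvd_funpow_tent[OF assms(1) that, of k 1] by simp
  qed
  then show ?thesis using assms(2) by (auto simp: prime_nat_iff)
qed

section \<open>Lengths of terminal cycles\<close>

lemma card_terminal_cycle_le:
  assumes "odd B" "3 < B" "terminal_cycle B C"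
  shows "card C \<le> pm_order B"
proof -
  obtain x y where xy: "x \<in> odds B" "y \<in> odds B" "x \<noteq> y" "C = orbit (kaprekar B) (gap_string B x y)"
    using terminal_cycle_regular[OF assms] .
  show ?thesis unfolding xy(4)
    using funpow_kaprekar_regular[OF assms(1) xy(1-3)] funpow_tent_id[OF assms(1)] xy
      pm_order_props[OF assms(1)]
    by (intro card_orbit_le) auto
qed

text \<open>For \<open>B = 5\<close> the tent map swaps 1 and 3, so the unordered pair is already fixed and the
  cycle is shorter than \<open>pm_order 5 = 2\<close>.\<close>

lemma card_terminal_cycle_5:
  assumes "terminal_cycle 5 C"
  shows "card C \<le> 1"
proof -
  obtain x y where xy: "x \<in> odds 5" "y \<in> odds 5" "x \<noteq> y" "C = orbit (kaprekar 5) (gap_string 5 x y)"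
    using terminal_cycle_regular[of 5 C] assms by auto
  have o: "odds 5 = {1, 3}"
  proof -
    have "{x. odd x \<and> x < (5::nat)} = set (filter odd [0..<5])" by auto
    then show ?thesis by (simp add: odds_def upt_rec numeral_3_eq_3)
  qed
  have "kaprekar 5 (gap_string 5 x y) = gap_string 5 (tent 5 x) (tent 5 y)"
    using xy by (intro kaprekar_regular) auto
  also have "\<dots> = gap_string 5 x y"
    using xy(1-3) unfolding o by (auto simp: tent_def gap_string_commute)
  finally show ?thesis unfolding xy(4) by (intro card_orbit_le) auto
qed

text \<open>Before \<open>pm_order B\<close> steps the pair \<open>{1, tent B 1}\<close> could
  return only with its members swapped. That would make \<open>tent B (tent B 1) = B - 4\<close>
  equal to 1, which \<open>7 <= B\<close> excludes. For \<open>B = 5\<close> the cycle still exists,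
  so the set of cycle lengths is never empty.\<close>

lemma terminal_cycle_pm_order:
  assumes "odd B" "3 < B"
  shows "\<exists>C. terminal_cycle B C \<and> (7 \<le> B \<longrightarrow> card C = pm_order B)"
proof -
  let ?g = "gap_string B 1 (B - 2)"
  let ?m = "pm_order B"
  have o: "1 \<in> odds B" "B - 2 \<in> odds B" "1 \<noteq> B - 2" using assms by (auto simp: odds_def)
  have t: "tent B 1 = B - 2" using assms by (simp add: tent_def)
  note it = funpow_kaprekar_regular[OF assms(1) o]
  have per: "(kaprekar B ^^ ?m) ?g = ?g"
    unfolding it using funpow_tent_id[OF assms(1)] pm_order_props[OF assms(1)] o by simp
  have "(kaprekar B ^^ k) ?g \<noteq> ?g" if k: "0 < k" "k < ?m" "7 \<le> B" for k
  proof
    assume "(kaprekar B ^^ k) ?g = ?g"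
    moreover have "(tent B ^^ k) 1 \<noteq> 1" using funpow_tent_one_neq[OF k(1,2)] .
    ultimately have "(tent B ^^ k) (tent B 1) = 1" "(tent B ^^ k) 1 = tent B 1"
      unfolding it using gap_string_eq_iff funpow_tent_mem_odds[OF assms(1)] odds_pos o t by metis+
    then have "tent B (tent B 1) = 1" by (metis funpow_swap1)
    then show False using k(3) by (auto simp: tent_def split: if_splits)
  qed
  then have "7 \<le> B \<longrightarrow> card (orbit (kaprekar B) ?g) = ?m"
    using per pm_order_props[OF assms(1)] by (auto intro!: card_orbit_eq)
  moreover have "terminal_cycle B (orbit (kaprekar B) ?g)"
    using per pm_order_props[OF assms(1)] o assms(1) by (intro terminal_cycleI) auto
  ultimately show ?thesis by blast
qed

theorem corollary1p2:
  fixes B :: nat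
  assumes "B > 3" and "odd B"
  shows "c_max B \<le> (B - 1) div 2 \<and>
    (c_max B = (B - 1) div 2 \<longleftrightarrow>
       B \<ge> 7 \<and> prime B \<and>
       (LEAST m::nat. m > 0 \<and> ([2 ^ m = 1] (mod int B) \<or> [2 ^ m = - 1] (mod int B)))
         = (B - 1) div 2)"
proof -
  let ?S = "{card C | C. terminal_cycle B C}"
  have le: "n \<le> pm_order B" if "n \<in> ?S" for n
    using that card_terminal_cycle_le assms by blast
  \<comment> \<open>Finiteness and nonemptiness ensure that \<open>Max\<close> is an actual cycle
    length.\<close>
  have fin: "finite ?S"
    using le by (intro finite_subset[of ?S "{..pm_order B}"]) auto
  have ne: "?S \<noteq> {}"
    using terminal_cycle_pm_order[OF assms(2,1)] by blast
  have mem: "c_max B \<in> ?S" unfolding c_max_def using fin ne by (rule Max_in)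
  then have cle: "c_max B \<le> pm_order B" by (rule le)
  have big: "c_max B = pm_order B" if "7 \<le> B"
  proof (rule antisym[OF cle])
    have "pm_order B \<in> ?S"
      using terminal_cycle_pm_order[OF assms(2,1)] that by (metis (mono_tags, lifting) mem_Collect_eq)
    then show "pm_order B \<le> c_max B" unfolding c_max_def using fin by (intro Max_ge)
  qed
  have small: "c_max B \<noteq> (B - 1) div 2" if "\<not> 7 \<le> B"
  proof -
    have "B = 4 \<or> B = 5 \<or> B = 6" using that assms(1) by linarith
    then have "B = 5" using assms(2) by auto
    then have "c_max B \<le> 1" using mem card_terminal_cycle_5 by auto
    then show ?thesis using \<open>B = 5\<close> by simp
  qed
  have pl: "pm_order B \<le> (B - 1) div 2" using pm_order_le assms by blast
  have "c_max B = (B - 1) div 2 \<longleftrightarrow> 7 \<le> B \<and> prime B \<and> pm_order B = (B - 1) div 2"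
    using big small pm_order_eq_imp_prime[OF assms(2,1)] by (cases "7 \<le> B") auto
  then show ?thesis using cle pl unfolding pm_order_def pm_cong_def by auto
qed

end
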